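(* Let $X$ and $Y$ be real or complex inner product spaces, and let $\langle\cdot,\cdot\rangle$ denote the real inner product on each of them. For any function $f:X\to Y$, the following five statements are equivalent: (i) $\big\{\|f(x)+f(y)\|,\|f(x)-f(y)\|\big\}=\big\{\|x+y\|,\|x-y\|\big\}$ for all $x,y\in X$ (equality of sets of real numbers); (ii) $\|f(x)+f(y)\|+\|f(x)-f(y)\|=\|x+y\|+\|x-y\|$ for all $x,y\in X$; (iii) $f(0)=0$ and $\|f(x)+f(y)\|\,\|f(x)-f(y)\|=\|x+y\|\,\|x-y\|$ for all $x,y\in X$; (iv) $|\langle f(x),f(y)\rangle|=|\langle x,y\rangle|$ for all $x,y\in X$; (v) there exists a function $\varepsilon:X\to\{-1,1\}$ such that $\varepsilon f$ (i.e. the map $x\mapsto\varepsilon(x)f(x)$) is a norm-preserving real linear map.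
   Context: Each of $X$ and $Y$ is regarded as a real inner product space: if the given inner product on the space is complex, then $\langle x,y\rangle$ denotes the real part of that complex inner product, which is a real inner product inducing the same norm; if the given inner product is real, $\langle\cdot,\cdot\rangle$ is that inner product. The norm $\|\cdot\|$ is the one induced by the inner product. Completeness is not assumed. A function $g:X\to Y$ is called real linear if it is additive and homogeneous with respect to real scalars; it is norm-preserving if $\|g(x)\|=\|x\|$ for all $x\in X$. *)

theory Defs
  imports "HOL-Analysis.Analysis"
begin

text \<open>
  The class \<open>real_inner\<close> is that of real inner product spaces; completeness is not part of it.
  It also covers complex inner product spaces, which enter only through the real part of their
  inner product: the lemma \<open>real_inner_of_complex\<close> below shows that restricting the scalars to the
  reals and taking the real part turns every complex inner product space into an instance of
  \<open>real_inner\<close>, with the same norm.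
\<close>

locale complex_inner_product = vector_space scaleC
  for scaleC :: "complex \<Rightarrow> 'a::ab_group_add \<Rightarrow> 'a" +
  fixes cinner :: "'a \<Rightarrow> 'a \<Rightarrow> complex"
  assumes cinner_commute: "cinner x y = cnj (cinner y x)"
    and cinner_add_left: "cinner (x + y) z = cinner x z + cinner y z"
    and cinner_scale_left: "cinner (scaleC c x) y = c * cinner x y"
    and cinner_ge_zero: "0 \<le> Re (cinner x x)"
    and cinner_eq_zero_iff: "cinner x x = 0 \<longleftrightarrow> x = 0"
begin

definition cnorm :: "'a \<Rightarrow> real"
  where "cnorm x = sqrt (cmod (cinner x x))"

definition cdist :: "'a \<Rightarrow> 'a \<Rightarrow> real"
  where "cdist x y = cnorm (x - y)"

definition csgn :: "'a \<Rightarrow> 'a"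
  where "csgn x = scaleC (of_real (inverse (cnorm x))) x"

definition cuniformity :: "('a \<times> 'a) filter"
  where "cuniformity = (INF e\<in>{0<..}. principal {(x, y). cdist x y < e})"

definition copen :: "'a set \<Rightarrow> bool"
  where "copen U \<longleftrightarrow> (\<forall>x\<in>U. eventually (\<lambda>(x', y). x' = x \<longrightarrow> y \<in> U) cuniformity)"

lemma real_inner_of_complex:
  "class.real_inner (-) cdist cnorm (+) 0 uminus (\<lambda>r. scaleC (of_real r)) csgn
     cuniformity copen (\<lambda>x y. Re (cinner x y))"
proof -
  have Im0: "Im (cinner x x) = 0" for x
    using cinner_commute[of x x] by (simp add: complex_eq_iff)
  have self: "cinner x x = of_real (Re (cinner x x))" for x
    by (simp add: complex_eq_iff Im0)
  show ?thesis
  proof (unfold_locales)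
    show "Re (cinner x y) = Re (cinner y x)" for x y
      using cinner_commute[of x y] by simp
    show "Re (cinner x x) = 0 \<longleftrightarrow> x = 0" for x
      using self[of x] cinner_eq_zero_iff[of x] by (metis of_real_eq_0_iff)
    show "cnorm x = sqrt (Re (cinner x x))" for x
      unfolding cnorm_def by (subst self) (simp only: norm_of_real abs_of_nonneg cinner_ge_zero)
  qed (simp_all add: cdist_def csgn_def cuniformity_def copen_def scale_right_distrib
         scale_left_distrib cinner_add_left cinner_scale_left cinner_ge_zero)
qed

end

end

theory Submission
  imports Defs
begin

text \<open>
  Conditions (i)-(iii) are disguises of (iv). By the parallelogram law, the squares of
  \<open>\<parallel>x + y\<parallel>\<close> and \<open>\<parallel>x - y\<parallel>\<close> are \<open>N \<plusminus> 2\<langle>x,y\<rangle>\<close> with \<open>N = \<parallel>x\<parallel>\<^sup>2 + \<parallel>y\<parallel>\<^sup>2\<close>. As soon as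
  \<open>f\<close> preserves norms, \<open>N\<close> is the same for the images, so the unordered pair of these two numbers,
  their sum and their product each determine, and are determined by, \<open>\<bar>\<langle>x,y\<rangle>\<bar>\<close>
  (lemmas \<open>norm_add_mult_norm_diff\<close> and \<open>abs_inner_eq_iff_norm_mult_eq\<close>). Each of the conditions
  forces preservation of norms by specialising to \<open>y = x\<close> or to \<open>y = 0\<close>.

  The implication from (iv) to (v) is the real form of Wigner's theorem. A map \<open>f\<close> as in (iv) sends
  a linear combination of two orthogonal vectors to the same combination of their images up to two
  signs (\<open>orthogonal_combination\<close>). Fix a unit vector \<open>e\<close>. For \<open>h\<close> orthogonal to \<open>e\<close> there is a sign
  \<open>\<sigma> h\<close> with \<open>f (e + h) = \<plusminus>(f e + \<sigma> h f h)\<close> (\<open>relative_sign_exists\<close>). Comparing \<open>f (e + h)\<close> with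
  \<open>f (e + k)\<close> shows that \<open>h \<mapsto> \<sigma> h f h\<close> preserves inner products, and not only their absolute values:
  \<open>\<bar>1 - p\<bar> = \<bar>1 + p\<bar>\<close> only if \<open>p = 0\<close> (\<open>relative_sign_inner\<close>). Therefore
  \<open>G (t e + h) = t f e + \<sigma> h f h\<close> preserves inner products, which already makes it linear and
  isometric. Comparing \<open>f (t e + h)\<close> with \<open>f (e + h)\<close> in the same manner shows that
  \<open>G\<close> agrees with \<open>f\<close> up to a sign at every point (\<open>sign_rectification\<close>).
\<close>

section \<open>Norms of sums and differences versus inner products\<close>

lemma norm_add_mult_norm_diff:
  fixes x y :: "'a::real_inner"
  shows "(norm (x + y) * norm (x - y))\<^sup>2
           = ((norm x)\<^sup>2 + (norm y)\<^sup>2)\<^sup>2 - 4 * (inner x y)\<^sup>2"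
proof -
  have "(norm (x + y) * norm (x - y))\<^sup>2
          = ((norm x)\<^sup>2 + (norm y)\<^sup>2 + 2 * inner x y) * ((norm x)\<^sup>2 + (norm y)\<^sup>2 - 2 * inner x y)"
    by (simp add: power_mult_distrib power2_norm_eq_inner inner_add inner_diff inner_commute)
  then show ?thesis
    by (simp add: power2_eq_square algebra_simps)
qed

lemma abs_inner_eq_iff_norm_mult_eq:
  fixes x y :: "'a::real_inner" and u v :: "'b::real_inner"
  assumes "norm u = norm x" and "norm v = norm y"
  shows "\<bar>inner u v\<bar> = \<bar>inner x y\<bar>
           \<longleftrightarrow> norm (u + v) * norm (u - v) = norm (x + y) * norm (x - y)"
proof -
  have "norm (u + v) * norm (u - v) = norm (x + y) * norm (x - y)
          \<longleftrightarrow> (norm (u + v) * norm (u - v))\<^sup>2 = (norm (x + y) * norm (x - y))\<^sup>2"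
    by (rule power2_eq_iff_nonneg[symmetric]) simp_all
  also have "\<dots> \<longleftrightarrow> (inner u v)\<^sup>2 = (inner x y)\<^sup>2"
    by (simp add: norm_add_mult_norm_diff assms)
  finally show ?thesis
    by (simp add: abs_eq_iff power2_eq_iff)
qed

lemma norm_mult_eq_if_norm_add_eq:
  fixes x y :: "'a::real_inner" and u v :: "'b::real_inner"
  assumes "norm u = norm x" and "norm v = norm y"
    and sum: "norm (u + v) + norm (u - v) = norm (x + y) + norm (x - y)"
  shows "norm (u + v) * norm (u - v) = norm (x + y) * norm (x - y)"
proof -
  have self: "inner u u = inner x x" "inner v v = inner y y"
    using assms(1,2) by (simp_all add: norm_eq_sqrt_inner)
  have "(norm (u + v))\<^sup>2 + (norm (u - v))\<^sup>2 = (norm (x + y))\<^sup>2 + (norm (x - y))\<^sup>2"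
    using self by (simp add: power2_norm_eq_inner inner_add inner_diff inner_commute)
  then show ?thesis
    using arg_cong[OF sum, of "\<lambda>s. s\<^sup>2"] by (simp add: power2_sum)
qed

lemma norm_pair_eq_if_abs_inner_eq:
  fixes x y :: "'a::real_inner" and u v :: "'b::real_inner"
  assumes "norm u = norm x" and "norm v = norm y" and "\<bar>inner u v\<bar> = \<bar>inner x y\<bar>"
  shows "{norm (u + v), norm (u - v)} = {norm (x + y), norm (x - y)}"
proof -
  have self: "inner u u = inner x x" "inner v v = inner y y"
    using assms(1,2) by (simp_all add: norm_eq_sqrt_inner)
  consider "inner u v = inner x y" | "inner u v = - inner x y"
    using assms(3) by (auto simp: abs_eq_iff)
  then show ?thesis
  proof cases
    case 1
    then have "norm (u + v) = norm (x + y)" "norm (u - v) = norm (x - y)"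
      using self by (simp_all add: norm_eq_sqrt_inner inner_add inner_diff inner_commute)
    then show ?thesis by simp
  next
    case 2
    then have "norm (u + v) = norm (x - y)" "norm (u - v) = norm (x + y)"
      using self by (simp_all add: norm_eq_sqrt_inner inner_add inner_diff inner_commute)
    then show ?thesis by auto
  qed
qed

section \<open>Maps that preserve absolute values of inner products\<close>

text \<open>
  The defect \<open>g (x + y) - g x - g y\<close> has zero inner product with itself, because this product
  expands into inner products of values of \<open>g\<close>, and the same expansion for the identity is zero.
\<close>

lemma linear_if_preserves_inner:
  fixes g :: "'a::real_inner \<Rightarrow> 'b::real_inner"
  assumes g: "\<And>x y. inner (g x) (g y) = inner x y"
  shows "linear g"
proof
  fix x y :: 'a and r :: real
  have "inner (g (x + y) - g x - g y) (g (x + y) - g x - g y) = 0"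
    by (simp add: inner_diff_left inner_diff_right g inner_add inner_commute)
  then have "g (x + y) - g x - g y = 0"
    by (simp only: inner_eq_zero_iff)
  then show "g (x + y) = g x + g y"
    by (simp add: algebra_simps)
  have "inner (g (r *\<^sub>R x) - r *\<^sub>R g x) (g (r *\<^sub>R x) - r *\<^sub>R g x) = 0"
    by (simp add: inner_diff_left inner_diff_right g)
  then have "g (r *\<^sub>R x) - r *\<^sub>R g x = 0"
    by (simp only: inner_eq_zero_iff)
  then show "g (r *\<^sub>R x) = r *\<^sub>R g x"
    by simp
qed

lemma linear_isometry_preserves_inner:
  fixes g :: "'a::real_inner \<Rightarrow> 'b::real_inner"
  assumes "linear g" and "\<And>x. norm (g x) = norm x"
  shows "inner (g x) (g y) = inner x y"
  by (simp add: dot_norm assms flip: linear_add[OF assms(1)])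

lemma abs_eq_obtains_sign:
  fixes a b :: real
  assumes "\<bar>a\<bar> = \<bar>b\<bar>"
  obtains s where "s \<in> {-1, 1}" and "a = s * b"
  using assms by (metis abs_eq_iff insertCI mult_1 mult_minus_left)

locale abs_inner_preserving =
  fixes f :: "'a::real_inner \<Rightarrow> 'b::real_inner"
  assumes abs_inner: "\<bar>inner (f x) (f y)\<bar> = \<bar>inner x y\<bar>"
begin

lemma inner_self: "inner (f x) (f x) = inner x x"
  using abs_inner[of x x] by simp

lemma norm_eq: "norm (f x) = norm x"
  by (simp add: norm_eq_sqrt_inner inner_self)

lemma orthogonal_iff: "inner (f x) (f y) = 0 \<longleftrightarrow> inner x y = 0"
  using abs_inner[of x y] by auto

text \<open>
  The coefficients of the orthogonal projection of \<open>f (a x + b y)\<close> to the span of \<open>f x\<close> and \<open>f y\<close> are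
  \<open>\<plusminus>a\<close> and \<open>\<plusminus>b\<close>; by Pythagoras this projection is as long as the vector itself, so nothing is left
  outside the span.
\<close>

lemma orthogonal_combination:
  assumes "inner x y = 0"
  obtains s t where "s \<in> {-1, 1}" and "t \<in> {-1, 1}"
    and "f (a *\<^sub>R x + b *\<^sub>R y) = (s * a) *\<^sub>R f x + (t * b) *\<^sub>R f y"
proof -
  define z where "z = f (a *\<^sub>R x + b *\<^sub>R y)"
  have xy: "inner x y = 0" "inner y x = 0" "inner (f x) (f y) = 0" "inner (f y) (f x) = 0"
    using assms by (simp_all add: orthogonal_iff inner_commute)
  have "\<bar>inner z (f x)\<bar> = \<bar>a * inner x x\<bar>" "\<bar>inner z (f y)\<bar> = \<bar>b * inner y y\<bar>"
    by (simp_all add: z_def abs_inner inner_add_left xy)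
  then obtain s t where s: "s \<in> {-1, 1}" "inner z (f x) = s * (a * inner x x)"
    and t: "t \<in> {-1, 1}" "inner z (f y) = t * (b * inner y y)"
    by (meson abs_eq_obtains_sign)
  have st: "s * s = 1" "t * t = 1"
    using s(1) t(1) by auto
  have zz: "inner z z = a * a * inner x x + b * b * inner y y"
    by (simp add: z_def inner_self inner_add xy)
  have zf: "inner (f x) z = inner z (f x)" "inner (f y) z = inner z (f y)"
    by (rule inner_commute)+
  define w where "w = z - (s * a) *\<^sub>R f x - (t * b) *\<^sub>R f y"
  have "inner w w = inner z z - 2 * (s * a) * inner z (f x) - 2 * (t * b) * inner z (f y)
          + (s * s) * (a * a) * inner x x + (t * t) * (b * b) * inner y y"
    by (simp add: w_def inner_diff_left inner_diff_right xy inner_self zf)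
       (simp add: algebra_simps)
  also have "\<dots> = inner z z - (s * s) * (a * a * inner x x) - (t * t) * (b * b * inner y y)"
    by (simp add: s(2) t(2) algebra_simps)
  also have "\<dots> = 0"
    by (simp add: st zz)
  finally have "w = 0"
    by (simp only: inner_eq_zero_iff)
  then have "z = (s * a) *\<^sub>R f x + (t * b) *\<^sub>R f y"
    by (simp add: w_def algebra_simps)
  then show ?thesis
    using that s(1) t(1) by (simp add: z_def)
qed

section \<open>Signs relative to a unit vector\<close>

text \<open>
  This is a relation and not a function because \<open>h = 0\<close> admits both signs; the disjunction
  discards the overall sign of \<open>f (e + h)\<close>, which is arbitrary.
\<close>

definition is_relative_sign :: "'a \<Rightarrow> 'a \<Rightarrow> real \<Rightarrow> bool"
  where "is_relative_sign e h r \<longleftrightarrow> r \<in> {-1, 1} \<and>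
           (f (e + h) = f e + r *\<^sub>R f h \<or> f (e + h) = - (f e + r *\<^sub>R f h))"

lemma relative_sign_exists:
  assumes "inner e h = 0"
  obtains r where "is_relative_sign e h r"
proof -
  obtain s t where st: "s \<in> {-1, 1}" "t \<in> {-1, 1}"
    and eq: "f (1 *\<^sub>R e + 1 *\<^sub>R h) = (s * 1) *\<^sub>R f e + (t * 1) *\<^sub>R f h"
    using orthogonal_combination[OF assms] by metis
  have "is_relative_sign e h (s * t)"
    using st eq unfolding is_relative_sign_def by auto
  then show ?thesis by (rule that)
qed

text \<open>
  Adding \<open>e\<close> to both vectors shifts their inner product by 1 in the domain, and by 1 in the codomain
  once the signs are relative to \<open>e\<close>. A number is determined by its own absolute value together with
  that of its shift.
\<close>

lemma relative_sign_inner: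
  assumes e: "norm e = 1" and eh: "inner e h = 0" and ek: "inner e k = 0"
    and r: "is_relative_sign e h r" and q: "is_relative_sign e k q"
  shows "inner (r *\<^sub>R f h) (q *\<^sub>R f k) = inner h k"
proof -
  have ee: "inner e e = 1" "inner (f e) (f e) = 1"
    using e by (simp_all add: inner_self norm_eq_1)
  have orth: "inner (f e) (f h) = 0" "inner (f h) (f e) = 0" "inner (f e) (f k) = 0"
    using eh ek by (simp_all add: orthogonal_iff inner_commute)
  have "\<bar>inner (f (e + h)) (f (e + k))\<bar> = \<bar>inner (f e + r *\<^sub>R f h) (f e + q *\<^sub>R f k)\<bar>"
    using r q unfolding is_relative_sign_def
    by (elim conjE disjE) (simp_all only: inner_minus_left inner_minus_right abs_minus_cancel minus_minus)
  then have shifted: "\<bar>1 + inner (r *\<^sub>R f h) (q *\<^sub>R f k)\<bar> = \<bar>1 + inner h k\<bar>"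
    by (simp add: abs_inner inner_add_left inner_add_right ee orth eh ek inner_commute[of h e])
  have "\<bar>inner (r *\<^sub>R f h) (q *\<^sub>R f k)\<bar> = \<bar>inner h k\<bar>"
    using r q abs_inner[of h k] by (auto simp: is_relative_sign_def)
  with shifted show ?thesis
    by linarith
qed

text \<open>
  The sign found for \<open>e + h\<close> serves for every \<open>t e + h\<close>: with the opposite sign, the inner product
  with \<open>f (e + h)\<close> would be \<open>\<plusminus>(t - \<parallel>h\<parallel>\<^sup>2)\<close> where it must be \<open>\<plusminus>(t + \<parallel>h\<parallel>\<^sup>2)\<close>, so one of the two terms
  is zero, and then the choice of the sign has no effect.
\<close>

lemma relative_sign_combination:
  assumes e: "norm e = 1" and eh: "inner e h = 0" and r: "is_relative_sign e h r"
  shows "f (t *\<^sub>R e + h) = t *\<^sub>R f e + r *\<^sub>R f h \<or> f (t *\<^sub>R e + h) = - (t *\<^sub>R f e + r *\<^sub>R f h)"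
proof -
  obtain s u where su: "s \<in> {-1, 1}" "u \<in> {-1, 1}"
    and "f (t *\<^sub>R e + 1 *\<^sub>R h) = (s * t) *\<^sub>R f e + (u * 1) *\<^sub>R f h"
    using orthogonal_combination[OF eh] by metis
  then have fx: "f (t *\<^sub>R e + h) = (s * t) *\<^sub>R f e + u *\<^sub>R f h"
    by simp
  have r1: "r \<in> {-1, 1}"
    using r by (simp add: is_relative_sign_def)
  have ee: "inner e e = 1" "inner (f e) (f e) = 1"
    using e by (simp_all add: inner_self norm_eq_1)
  have orth: "inner (f e) (f h) = 0" "inner (f h) (f e) = 0" "inner h e = 0"
    using eh by (simp_all add: orthogonal_iff inner_commute)
  have "\<bar>inner (f (t *\<^sub>R e + h)) (f (e + h))\<bar>
          = \<bar>inner ((s * t) *\<^sub>R f e + u *\<^sub>R f h) (f e + r *\<^sub>R f h)\<bar>"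
    using r unfolding is_relative_sign_def fx
    by (elim conjE disjE) (simp_all only: inner_minus_right abs_minus_cancel)
  then have cmp: "\<bar>t + inner h h\<bar> = \<bar>s * t + u * r * inner h h\<bar>"
    by (simp add: abs_inner inner_add_left inner_add_right ee orth eh inner_self mult_ac)
  have "u = s * r \<or> t = 0 \<or> inner h h = 0"
    using su r1 cmp by (auto simp del: inner_eq_zero_iff)
  then consider "u = s * r" | "t = 0" | "h = 0"
    by auto
  then show ?thesis
  proof cases
    case 1
    then show ?thesis using su fx by auto
  next
    case 2
    then show ?thesis using su r1 fx by auto
  next
    case 3
    then have "f h = 0"
      using norm_eq[of h] by simp
    then show ?thesis using su fx by auto
  qed
qed

section \<open>The real form of Wigner's theorem\<close>

theorem sign_rectification:
  obtains \<epsilon> :: "'a \<Rightarrow> real" where "range \<epsilon> \<subseteq> {-1, 1}"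
    and "linear (\<lambda>x. \<epsilon> x *\<^sub>R f x)" and "\<And>x. norm (\<epsilon> x *\<^sub>R f x) = norm x"
proof -
  \<comment> \<open>Any \<open>G\<close> that preserves inner products is linear and isometric, so it suffices to find
    one that differs from \<open>f\<close> only by signs.\<close>
  have "\<exists>G. (\<forall>x y. inner (G x) (G y) = inner x y) \<and> (\<forall>x. f x = G x \<or> f x = - G x)"
  proof (cases "\<exists>v::'a. v \<noteq> 0")
    case False
    then have "x = 0" for x :: 'a by blast
    then have "inner (f x) (f y) = inner x y" for x y
      by (metis inner_self)
    then show ?thesis by blast
  next
    case True
    then obtain v :: 'a where "v \<noteq> 0" by blast
    define e where "e = sgn v"
    have e: "norm e = 1"
      using \<open>v \<noteq> 0\<close> by (simp add: e_def norm_sgn)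
    then have ee: "inner e e = 1" "inner (f e) (f e) = 1"
      by (simp_all add: inner_self norm_eq_1)
    define h where "h x = x - inner e x *\<^sub>R e" for x
    have eh: "inner e (h x) = 0" for x
      by (simp add: h_def inner_diff_right ee)
    have split: "inner e x *\<^sub>R e + h x = x" for x
      by (simp add: h_def)
    have "\<exists>r. is_relative_sign e (h x) r" for x
      using relative_sign_exists[OF eh] by blast
    then obtain \<sigma> where \<sigma>: "is_relative_sign e (h x) (\<sigma> x)" for x
      by metis
    define G where "G x = inner e x *\<^sub>R f e + \<sigma> x *\<^sub>R f (h x)" for x
    have orth: "inner (f e) (f (h x)) = 0" "inner (f (h x)) (f e) = 0" for x
      using eh by (simp_all add: orthogonal_iff inner_commute)
    have "inner (G x) (G y) = inner x y" for x y
    proof -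
      have "inner (G x) (G y)
              = inner e x * inner e y + inner (\<sigma> x *\<^sub>R f (h x)) (\<sigma> y *\<^sub>R f (h y))"
        by (simp add: G_def inner_add_left inner_add_right ee orth)
      also have "\<dots> = inner e x * inner e y + inner (h x) (h y)"
        by (simp only: relative_sign_inner[OF e eh eh \<sigma> \<sigma>])
      also have "\<dots> = inner x y"
        by (simp add: h_def inner_diff_left inner_diff_right ee inner_commute)
      finally show ?thesis .
    qed
    moreover have "f x = G x \<or> f x = - G x" for x
      using relative_sign_combination[OF e eh \<sigma>, of "inner e x" x] by (simp add: split G_def)
    ultimately show ?thesis by blast
  qed
  then obtain G where G: "\<And>x y. inner (G x) (G y) = inner x y"
    and sign: "\<And>x. f x = G x \<or> f x = - G x"
    by blast
  define \<epsilon> :: "'a \<Rightarrow> real" where "\<epsilon> x = (if f x = G x then 1 else -1)" for x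
  have \<epsilon>: "(\<lambda>x. \<epsilon> x *\<^sub>R f x) = G"
  proof
    show "\<epsilon> x *\<^sub>R f x = G x" for x
      using sign[of x] by (cases "f x = G x") (simp_all add: \<epsilon>_def)
  qed
  show ?thesis
  proof
    show "range \<epsilon> \<subseteq> {-1, 1}"
      by (auto simp: \<epsilon>_def)
    show "linear (\<lambda>x. \<epsilon> x *\<^sub>R f x)"
      unfolding \<epsilon> using G by (rule linear_if_preserves_inner)
    show "norm (\<epsilon> x *\<^sub>R f x) = norm x" for x
      using fun_cong[OF \<epsilon>, of x] by (simp add: norm_eq_sqrt_inner G del: inner_scaleR_left)
  qed
qed

end

section \<open>Equivalence of the five conditions\<close>

theorem theorem2:
  fixes f :: "'a::real_inner \<Rightarrow> 'b::real_inner"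
  shows
    "let
       P1 = (\<forall>x y. {norm (f x + f y), norm (f x - f y)} = {norm (x + y), norm (x - y)});
       P2 = (\<forall>x y. norm (f x + f y) + norm (f x - f y) = norm (x + y) + norm (x - y));
       P3 = (f 0 = 0 \<and>
             (\<forall>x y. norm (f x + f y) * norm (f x - f y) = norm (x + y) * norm (x - y)));
       P4 = (\<forall>x y. \<bar>inner (f x) (f y)\<bar> = \<bar>inner x y\<bar>);
       P5 = (\<exists>\<epsilon> :: 'a \<Rightarrow> real. range \<epsilon> \<subseteq> {-1, 1} \<and>
               linear (\<lambda>x. \<epsilon> x *\<^sub>R f x) \<and> (\<forall>x. norm (\<epsilon> x *\<^sub>R f x) = norm x))
     in (P1 \<longleftrightarrow> P2) \<and> (P2 \<longleftrightarrow> P3) \<and> (P3 \<longleftrightarrow> P4) \<and> (P4 \<longleftrightarrow> P5)"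
proof -
  define P1 where "P1 = (\<forall>x y. {norm (f x + f y), norm (f x - f y)} = {norm (x + y), norm (x - y)})"
  define P2 where "P2 = (\<forall>x y. norm (f x + f y) + norm (f x - f y) = norm (x + y) + norm (x - y))"
  define P3 where "P3 = (f 0 = 0 \<and>
    (\<forall>x y. norm (f x + f y) * norm (f x - f y) = norm (x + y) * norm (x - y)))"
  define P4 where "P4 = (\<forall>x y. \<bar>inner (f x) (f y)\<bar> = \<bar>inner x y\<bar>)"
  define P5 where "P5 = (\<exists>\<epsilon> :: 'a \<Rightarrow> real. range \<epsilon> \<subseteq> {-1, 1} \<and>
    linear (\<lambda>x. \<epsilon> x *\<^sub>R f x) \<and> (\<forall>x. norm (\<epsilon> x *\<^sub>R f x) = norm x))"
  note defs = P1_def P2_def P3_def P4_def P5_def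
  have "P2" if P1
    unfolding P2_def
  proof (intro allI)
    fix x y
    have "{norm (f x + f y), norm (f x - f y)} = {norm (x + y), norm (x - y)}"
      using \<open>P1\<close> by (simp add: P1_def)
    then show "norm (f x + f y) + norm (f x - f y) = norm (x + y) + norm (x - y)"
      by (auto simp: doubleton_eq_iff)
  qed
  moreover have "P4" if P2
  proof -
    have sum: "norm (f x + f y) + norm (f x - f y) = norm (x + y) + norm (x - y)" for x y
      using \<open>P2\<close> by (simp add: P2_def)
    have "norm (2 *\<^sub>R f x) = norm (2 *\<^sub>R x)" for x
      using sum[of x x] unfolding scaleR_2 by simp
    then have "norm (f x) = norm x" for x
      by simp
    then show P4
      unfolding P4_def
      using abs_inner_eq_iff_norm_mult_eq norm_mult_eq_if_norm_add_eq sum by blast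
  qed
  moreover have "P4" if P3
  proof -
    have prod: "norm (f x + f y) * norm (f x - f y) = norm (x + y) * norm (x - y)" for x y
      using \<open>P3\<close> by (simp add: P3_def)
    have "f 0 = 0"
      using \<open>P3\<close> by (simp add: P3_def)
    then have "(norm (f x))\<^sup>2 = (norm x)\<^sup>2" for x
      using prod[of x 0] by (simp add: power2_eq_square)
    then have "norm (f x) = norm x" for x
      by simp
    then show P4
      unfolding P4_def using abs_inner_eq_iff_norm_mult_eq prod by blast
  qed
  moreover have "P1 \<and> P3 \<and> P5" if P4
  proof -
    interpret abs_inner_preserving f
      using \<open>P4\<close> by unfold_locales (simp add: P4_def)
    have "f 0 = 0"
      using norm_eq[of 0] by simp
    moreover have "norm (f x + f y) * norm (f x - f y) = norm (x + y) * norm (x - y)" for x y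
      using abs_inner_eq_iff_norm_mult_eq[OF norm_eq norm_eq] abs_inner by blast
    moreover have "{norm (f x + f y), norm (f x - f y)} = {norm (x + y), norm (x - y)}" for x y
      by (rule norm_pair_eq_if_abs_inner_eq[OF norm_eq norm_eq abs_inner])
    ultimately show ?thesis
      unfolding P1_def P3_def P5_def using sign_rectification by metis
  qed
  moreover have "P4" if P5
  proof -
    obtain \<epsilon> :: "'a \<Rightarrow> real" where \<epsilon>: "range \<epsilon> \<subseteq> {-1, 1}"
      and lin: "linear (\<lambda>x. \<epsilon> x *\<^sub>R f x)" and iso: "\<And>x. norm (\<epsilon> x *\<^sub>R f x) = norm x"
      using \<open>P5\<close> unfolding P5_def by blast
    have abs: "\<bar>\<epsilon> x\<bar> = 1" for x
      using \<epsilon> by (auto simp: image_subset_iff) (metis abs_1 abs_minus_cancel)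
    have "\<bar>inner (f x) (f y)\<bar> = \<bar>inner (\<epsilon> x *\<^sub>R f x) (\<epsilon> y *\<^sub>R f y)\<bar>" for x y
      by (simp add: abs_mult abs)
    then have "\<bar>inner (f x) (f y)\<bar> = \<bar>inner x y\<bar>" for x y
      by (simp only: linear_isometry_preserves_inner[OF lin iso])
    then show P4
      by (simp add: P4_def)
  qed
  ultimately have "(P1 \<longleftrightarrow> P2) \<and> (P2 \<longleftrightarrow> P3) \<and> (P3 \<longleftrightarrow> P4) \<and> (P4 \<longleftrightarrow> P5)"
    by blast
  then show ?thesis
    unfolding Let_def defs .
qed

end
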